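(* Let $c>0$ be fixed. For every $\eta>0$ there exists $n_0$ such that the following holds for all integers $n\geq n_0$ and $\lambda$ with $1\leq\lambda\leq n$: if $\mathcal{A},\mathcal{B}\subseteq 2^{[n]}$ are families with $|\mathcal{A}|=|\mathcal{B}|=m$ such that at least $cm^2$ pairs $(A,B)\in\mathcal{A}\times\mathcal{B}$ satisfy $|A\cap B|=\lambda$, then $m\leq 2^{(1/2+\eta)n}$.
   Context: $2^{[n]}$ denotes the family of all subsets of $[n]=\{1,\dots,n\}$. (The paper phrases the conclusion as $m\leq 2^{(1/2+o(1))n}$.) *)

theory Defs
  imports Complex_Main
begin

end

(* By orthogonality of the characters of Z/N, the density of pairs with |A \<inter> B| = l is at most 1/N
plus the maximum of |E w^|A \<inter> B|| over the nontrivial N-th roots of unity w. The matrix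
(w^|A \<inter> B|) indexed by pairs of subsets of [n] is the n-th tensor power of [[1, 1], [1, w]], so its
norm from l^p to l^q is the n-th power of the norm K^(1/q) of that 2x2 matrix, where p = q/(q-1).
As q tends to infinity, K tends to 2, whichever w \<noteq> 1 is taken. Hence each nontrivial
exponential sum is o(m^2) as soon as m exceeds 2^((1/2+\<eta>)n), and N > 2/c gives the contradiction. *)

theory Submission
  imports Defs "HOL-Analysis.Convex" "HOL-Real_Asymp.Real_Asymp"
begin

section \<open>The two-point inequality\<close>

text \<open>Quantifies the loss in the triangle inequality by the distance between the two
  directions. Both squared norms expand into inner products; if \<open>x\<close> or \<open>y\<close>
  is zero, the factor \<open>norm x * norm y\<close> removes the correction.\<close>

lemma norm_add_sgn:
  fixes x y :: "'a::real_inner"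
  shows "(norm (x + y))\<^sup>2 = (norm x + norm y)\<^sup>2 - norm x * norm y * (norm (sgn x - sgn y))\<^sup>2"
proof (cases "x = 0 \<or> y = 0")
  case False
  then have ss: "sgn x \<bullet> sgn x = 1" "sgn y \<bullet> sgn y = 1"
    by (simp_all add: dot_square_norm norm_sgn)
  have xy: "x \<bullet> y = norm x * norm y * (sgn x \<bullet> sgn y)"
    using False by (simp add: sgn_div_norm field_simps)
  have "(norm (x + y))\<^sup>2 = (norm x)\<^sup>2 + 2 * (x \<bullet> y) + (norm y)\<^sup>2"
    by (simp add: power2_norm_eq_inner inner_add inner_commute)
  moreover have "(norm (sgn x - sgn y))\<^sup>2 = 2 - 2 * (sgn x \<bullet> sgn y)"
    by (simp add: power2_norm_eq_inner inner_diff inner_commute ss)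
  ultimately show ?thesis
    by (simp only: xy) (simp add: power2_sum right_diff_distrib mult.left_commute)
qed auto

text \<open>The exponents \<open>1 + 1/r\<close> and \<open>Suc r\<close> are conjugate, and their
  quotient is \<open>r\<close>. Taking \<open>Suc r\<close> as the larger exponent keeps every outer
  power a natural one.\<close>

lemma powr_conjugate_power:
  fixes a :: real
  assumes "a \<ge> 0" "r \<ge> (1::nat)"
  shows "(a powr (1 + 1/r)) ^ r = a ^ Suc r"
proof (cases "a = 0")
  case False
  have "(1 + 1/r) * r = real (Suc r)" using assms(2) by (simp add: field_simps)
  then show ?thesis
    using False assms by (simp add: powr_realpow[symmetric] powr_powr del: power_Suc of_nat_Suc)
qed (use assms in simp)

text \<open>By convexity the worst case is \<open>a = b = 1/2\<close>, where the sum equals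
  \<open>(1/2) powr (1/r)\<close>.\<close>

lemma powr_sum_ge_half:
  fixes a b :: real
  assumes "a \<ge> 0" "b \<ge> 0" "a + b = 1" "r \<ge> (1::nat)"
  shows "(a powr (1 + 1/r) + b powr (1 + 1/r)) ^ r \<ge> 1/2"
proof -
  define p where "p = 1 + 1 / real r"
  have p: "p \<ge> 1" by (simp add: p_def)
  have mid: "(1/2::real) powr p \<le> (1/2) * a powr p + (1/2) * b powr p"
  proof (cases "a = 0 \<or> b = 0")
    case True
    have "(1/2::real) powr p \<le> (1/2) powr 1"
      using p by (intro powr_mono') auto
    then show ?thesis using True assms by auto
  next
    case False
    have "a / 2 + b / 2 = 1/2" using assms(3) by simp
    with convex_onD[OF powr_convex[OF p], of "1/2" a b] False assms show ?thesis
      by simp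
  qed
  have "1/2 = ((1/2::real) powr (1/r)) ^ r"
    using assms(4) by (simp add: powr_realpow[symmetric] powr_powr)
  also have "\<dots> \<le> (a powr p + b powr p) ^ r"
  proof (rule power_mono)
    have "(1/2::real) powr (1/r) = 2 * (1/2) powr p"
      by (simp add: p_def powr_add)
    then show "(1/2::real) powr (1/r) \<le> a powr p + b powr p"
      using mid by simp
  qed simp
  finally show ?thesis by (simp add: p_def)
qed

text \<open>The lower bound \<open>1 - H(a, b)\<close> is independent of \<open>r\<close>: the threshold below which \<open>b\<close> counts as
  tiny can therefore be fixed before \<open>r\<close> is chosen.\<close>

lemma powr_sum_ge_entropy:
  fixes a b :: real
  assumes "a > 0" "b > 0" "a + b = 1" "r \<ge> (1::nat)" "- (a * ln a) - b * ln b \<le> 1"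
  shows "(a powr (1 + 1/r) + b powr (1 + 1/r)) ^ r \<ge> 1 + a * ln a + b * ln b"
proof -
  \<comment> \<open>First-order expansion in \<open>1/r\<close>: the factor
    \<open>x powr (1/r)\<close> is \<open>exp (ln x / r)\<close>, which is at least
    \<open>1 + ln x / r\<close>.\<close>
  have *: "x powr (1 + 1/r) \<ge> x + x * ln x / r" if "x > 0" for x :: real
  proof -
    have "x powr (1 + 1/r) = x * exp (ln x / r)"
      using that by (simp add: powr_def distrib_right exp_add)
    also have "\<dots> \<ge> x * (1 + ln x / r)"
      using that by (intro mult_left_mono exp_ge_add_one_self) auto
    finally show ?thesis by (simp add: algebra_simps)
  qed
  define h where "h = a * ln a + b * ln b"
  have h: "h \<ge> -1" using assms(5) by (simp add: h_def)
  have "1 + h = 1 + real r * (h / r)" using assms(4) by simp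
  \<comment> \<open>Bernoulli cancels the dependence on \<open>r\<close>. The entropy hypothesis
    gives \<open>h \<ge> -1\<close>, which keeps the base nonnegative.\<close>
  also have "\<dots> \<le> (1 + h / r) ^ r"
  proof (rule Bernoulli_inequality)
    show "-1 \<le> h / r" using h assms(4) by (simp add: field_simps)
  qed
  also have "\<dots> \<le> (a powr (1 + 1/r) + b powr (1 + 1/r)) ^ r"
  proof (rule power_mono)
    show "1 + h / r \<le> a powr (1 + 1/r) + b powr (1 + 1/r)"
      using *[OF assms(1)] *[OF assms(2)] assms(3)
      by (simp add: h_def add_divide_distrib)
    show "0 \<le> 1 + h / r" using h assms(4) by (simp add: field_simps)
  qed
  finally show ?thesis by (simp add: h_def)
qed

lemma entropy_small:
  fixes \<epsilon> :: real
  assumes "\<epsilon> > 0"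
  obtains t where "0 < t" "t < 1/2"
    "\<And>b. 0 < b \<Longrightarrow> b \<le> t \<Longrightarrow> - ((1 - b) * ln (1 - b)) - b * ln b \<le> \<epsilon>"
proof -
  have "((\<lambda>b::real. - ((1 - b) * ln (1 - b)) - b * ln b) \<longlongrightarrow> 0) (at_right 0)"
    by real_asymp
  then have "\<forall>\<^sub>F b in at_right 0. - ((1 - b) * ln (1 - b)) - b * ln b < \<epsilon>"
    using assms by (rule order_tendstoD)
  then obtain d where "d > 0" "\<And>b. 0 < b \<Longrightarrow> b < d \<Longrightarrow> - ((1 - b) * ln (1 - b)) - b * ln b < \<epsilon>"
    by (auto simp: eventually_at_right_field)
  then show ?thesis
    by (intro that[of "min (1/3) (d/2)"]) (auto intro: less_imp_le)
qed

text \<open>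
  Normalise \<open>\<bar>x\<bar> + \<bar>y\<bar> = 1\<close>. If one of the two is tiny, the entropy bound makes the right-hand side
  at least \<open>2\<close>. Otherwise, as \<open>\<omega> \<noteq> 1\<close>, one of the two sums on the left has misaligned
  phases, so its norm is bounded away from \<open>1\<close> and its power negligible, while the right-hand
  side is at least \<open>K / 2 > 1\<close>.
\<close>

lemma two_point:
  fixes \<omega> :: complex and K :: real
  assumes "norm \<omega> = 1" "\<omega> \<noteq> 1" "K > 2"
  obtains r :: nat where "r \<ge> 1"
    "\<And>x y. norm (x + y) ^ Suc r + norm (x + \<omega> * y) ^ Suc r
      \<le> K * (norm x powr (1 + 1/r) + norm y powr (1 + 1/r)) ^ r"
proof -
  \<comment> \<open>Chosen so that \<open>K * (1 - \<epsilon>) = 2\<close>, the trivial bound for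
    the left-hand side when \<open>norm x + norm y = 1\<close>.\<close>
  define \<epsilon> where "\<epsilon> = 1 - 2 / K"
  have \<epsilon>: "0 < \<epsilon>" "\<epsilon> < 1" "K * (1 - \<epsilon>) = 2" using assms by (simp_all add: \<epsilon>_def)
  obtain t where t: "0 < t" "t < 1/2"
    "\<And>b. 0 < b \<Longrightarrow> b \<le> t \<Longrightarrow> - ((1 - b) * ln (1 - b)) - b * ln b \<le> \<epsilon>"
    using entropy_small[OF \<epsilon>(1)] by metis
  \<comment> \<open>The directions of \<open>y\<close> and \<open>\<omega> * y\<close> are
    \<open>2 * \<delta>\<close> apart, so no direction is within less than \<open>\<delta>\<close>
    of both. Then \<open>\<rho>\<close> is what \<open>norm_add_sgn\<close> yields when
    \<open>norm x * norm y \<ge> t / 2\<close> and the directions differ by at least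
    \<open>\<delta>\<close>.\<close>
  define \<delta> where "\<delta> = norm (1 - \<omega>) / 2"
  define \<rho> where "\<rho> = sqrt (1 - t / 2 * \<delta>\<^sup>2)"
  have "norm (1 - \<omega>) \<le> 2" using norm_triangle_ineq4[of 1 \<omega>] assms by simp
  then have \<delta>: "0 < \<delta>" "\<delta> \<le> 1" using assms by (auto simp: \<delta>_def)
  have \<rho>: "0 \<le> \<rho>" "\<rho> < 1" "\<rho>\<^sup>2 = 1 - t / 2 * \<delta>\<^sup>2"
  proof -
    have "\<delta>\<^sup>2 \<le> 1" using \<delta> by (simp add: power_le_one)
    then have "t / 2 * \<delta>\<^sup>2 \<le> 1 * 1" using t \<delta> by (intro mult_mono) auto
    moreover have "t / 2 * \<delta>\<^sup>2 > 0" using t \<delta> by simp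
    ultimately show "0 \<le> \<rho>" "\<rho> < 1" "\<rho>\<^sup>2 = 1 - t / 2 * \<delta>\<^sup>2" by (auto simp: \<rho>_def)
  qed
  \<comment> \<open>Neither \<open>t\<close> nor \<open>\<rho>\<close> involves \<open>r\<close>, so
    \<open>r\<close> may be taken large enough that
    \<open>1 + \<rho> ^ Suc r \<le> K / 2\<close>.\<close>
  have "\<exists>r0. \<rho> ^ r0 < K / 2 - 1" 
    using real_arch_pow_inv[of "K / 2 - 1" \<rho>] \<rho> assms by simp
  then obtain r0 where r0: "\<rho> ^ r0 < K / 2 - 1" by blast
  define r where "r = Suc r0"
  have r: "r \<ge> 1" by (simp add: r_def)
  have \<rho>r: "\<rho> ^ Suc r \<le> K / 2 - 1"
    using r0 power_decreasing[of r0 "Suc r" \<rho>] \<rho> by (simp add: r_def)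
  define p where "p = 1 + 1 / real r"
  have unit: "norm (x + y) ^ Suc r + norm (x + \<omega> * y) ^ Suc r \<le> K * (norm x powr p + norm y powr p) ^ r"
    if s: "norm x + norm y = 1" for x y :: complex
  proof -
    let ?G = "(norm x powr p + norm y powr p) ^ r"
    have le1: "norm (x + y) \<le> 1" "norm (x + \<omega> * y) \<le> 1"
      using norm_triangle_ineq[of x y] norm_triangle_ineq[of x "\<omega> * y"] s assms
      by (simp_all add: norm_mult)
    have half: "?G \<ge> 1/2"
      unfolding p_def by (rule powr_sum_ge_half) (use s r in auto)
    show ?thesis
    proof (cases "norm x \<le> t \<or> norm y \<le> t")
      case True
      have "?G \<ge> 1 - \<epsilon>"
      proof (cases "x = 0 \<or> y = 0")
        case True
        then have "?G = 1" using s by auto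
        then show ?thesis using \<epsilon> by simp
      next
        case False
        have one_minus: "1 - norm x = norm y" "1 - norm y = norm x" using s by simp_all
        have e: "- (norm x * ln (norm x)) - norm y * ln (norm y) \<le> \<epsilon>"
          using True
        proof
          assume "norm x \<le> t"
          then show ?thesis using t(3)[of "norm x"] False one_minus by simp
        next
          assume "norm y \<le> t"
          then show ?thesis using t(3)[of "norm y"] False one_minus by simp
        qed
        have "?G \<ge> 1 + norm x * ln (norm x) + norm y * ln (norm y)"
          unfolding p_def by (rule powr_sum_ge_entropy) (use s r False e \<epsilon> in auto)
        then show ?thesis using e by simp
      qed
      then have "K * ?G \<ge> 2"
        using mult_left_mono[of "1 - \<epsilon>" ?G K] \<epsilon> assms by simp
      moreover have "norm (x + y) ^ Suc r \<le> 1" "norm (x + \<omega> * y) ^ Suc r \<le> 1"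
        using le1 by (auto intro!: power_le_one simp del: power_Suc)
      ultimately show ?thesis by linarith
    next
      case False
      \<comment> \<open>Both norms exceed \<open>t\<close>, and since they add up to 1 the larger is
        at least 1/2.\<close>
      have ab: "norm x * norm y \<ge> t / 2"
      proof (cases "norm x \<ge> 1/2")
        case True
        then show ?thesis using mult_mono[of "1/2" "norm x" t "norm y"] False t by simp
      next
        case F: False
        then have "norm y \<ge> 1/2" using s by simp
        then show ?thesis using mult_mono[of t "norm x" "1/2" "norm y"] False t by simp
      qed
      have small: "norm (x + z) \<le> \<rho>" if "norm z = norm y" "norm (sgn x - sgn z) \<ge> \<delta>" for z
      proof -
        have "(norm (x + z))\<^sup>2 = 1 - norm x * norm y * (norm (sgn x - sgn z))\<^sup>2"
          using norm_add_sgn[of x z] s that by simp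
        also have "\<dots> \<le> 1 - t / 2 * \<delta>\<^sup>2"
          using ab t \<delta> that by (intro diff_mono mult_mono power_mono) auto
        finally show ?thesis using \<rho> by (metis power2_le_imp_le)
      qed
      have tri: "norm (sgn x - sgn y) \<ge> \<delta> \<or> norm (sgn x - sgn (\<omega> * y)) \<ge> \<delta>"
      proof (rule ccontr)
        assume neg: "\<not> ?thesis"
        have "y \<noteq> 0" using False t by auto
        have "sgn (\<omega> * y) = \<omega> * sgn y"
          using assms by (simp add: sgn_mult sgn_div_norm[of \<omega>])
        then have "sgn y - sgn (\<omega> * y) = (1 - \<omega>) * sgn y" by (simp add: algebra_simps)
        then have "norm (sgn y - sgn (\<omega> * y)) = 2 * \<delta>"
          using \<open>y \<noteq> 0\<close> by (simp add: norm_mult norm_sgn \<delta>_def)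
        moreover have "norm (sgn y - sgn (\<omega> * y)) \<le> norm (sgn x - sgn y) + norm (sgn x - sgn (\<omega> * y))"
          using norm_triangle_ineq4[of "sgn x - sgn (\<omega> * y)" "sgn x - sgn y"] by simp
        ultimately show False using neg by linarith
      qed
      have n\<omega>: "norm (\<omega> * y) = norm y" using assms by (simp add: norm_mult)
      from tri have "norm (x + y) ^ Suc r + norm (x + \<omega> * y) ^ Suc r \<le> 1 + \<rho> ^ Suc r"
      proof
        assume "norm (sgn x - sgn y) \<ge> \<delta>"
        then have "norm (x + y) ^ Suc r \<le> \<rho> ^ Suc r"
          by (intro power_mono small) auto
        moreover have "norm (x + \<omega> * y) ^ Suc r \<le> 1"
          using le1 by (auto intro!: power_le_one simp del: power_Suc)
        ultimately show ?thesis by linarith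
      next
        assume "norm (sgn x - sgn (\<omega> * y)) \<ge> \<delta>"
        then have "norm (x + \<omega> * y) ^ Suc r \<le> \<rho> ^ Suc r"
          by (intro power_mono small) (auto simp: n\<omega>)
        moreover have "norm (x + y) ^ Suc r \<le> 1"
          using le1 by (auto intro!: power_le_one simp del: power_Suc)
        ultimately show ?thesis by linarith
      qed
      also have "\<dots> \<le> K * (1/2)" using \<rho>r by simp
      also have "\<dots> \<le> K * ?G" using half assms by (intro mult_left_mono) auto
      finally show ?thesis .
    qed
  qed
  have "norm (x + y) ^ Suc r + norm (x + \<omega> * y) ^ Suc r \<le> K * (norm x powr p + norm y powr p) ^ r"
    for x y :: complex
  proof (cases "norm x + norm y = 0")
    case True
    then have "x = 0" "y = 0" by (auto simp: add_nonneg_eq_0_iff)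
    then show ?thesis using r by (simp add: power_0_left)
  next
    case False
    \<comment> \<open>Both sides are homogeneous of degree \<open>Suc r\<close>, so dividing by
      \<open>s\<close> reduces to the normalised case \<open>unit\<close>.\<close>
    define s where "s = norm x + norm y"
    have s: "s > 0" using False by (simp add: s_def less_le)
    have sp: "(s powr p) ^ r = s ^ Suc r"
      unfolding p_def using s r by (intro powr_conjugate_power) auto
    define x' y' where "x' = x /\<^sub>R s" and "y' = y /\<^sub>R s"
    have xy: "x = s *\<^sub>R x'" "y = s *\<^sub>R y'" using s by (simp_all add: x'_def y'_def)
    have "norm x' + norm y' = (norm x + norm y) / s"
      using s by (simp add: x'_def y'_def divide_inverse_commute distrib_left)
    then have 1: "norm x' + norm y' = 1" using s by (simp add: s_def)
    have "x + y = s *\<^sub>R (x' + y')" "x + \<omega> * y = s *\<^sub>R (x' + \<omega> * y')"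
      by (simp_all add: xy scaleR_add_right)
    then have "norm (x + y) ^ Suc r + norm (x + \<omega> * y) ^ Suc r
      = s ^ Suc r * (norm (x' + y') ^ Suc r + norm (x' + \<omega> * y') ^ Suc r)"
      by (simp only: norm_scaleR abs_of_pos[OF s] power_mult_distrib distrib_left)
    also have "\<dots> \<le> s ^ Suc r * (K * (norm x' powr p + norm y' powr p) ^ r)"
      using unit[OF 1] s by (intro mult_left_mono) auto
    also have "\<dots> = K * (s powr p * (norm x' powr p + norm y' powr p)) ^ r"
      unfolding power_mult_distrib sp by simp
    also have "s powr p * (norm x' powr p + norm y' powr p) = norm x powr p + norm y powr p"
      using s by (simp add: xy powr_mult distrib_left)
    finally show ?thesis .
  qed
  then show ?thesis using that[OF r] by (simp add: p_def)
qed

section \<open>Tensorisation over the coordinates of the ground set\<close>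

text \<open>The triangle inequality in l^r, stated without r-th roots and with a common factor
  \<open>C\<close> so that two induction hypotheses can be plugged in directly. For positive
  \<open>U\<close> and \<open>V\<close>, the sum \<open>u + v\<close> is a convex combination, with
  weights proportional to \<open>U\<close> and \<open>V\<close>, of rescaled copies of
  \<open>u\<close> and \<open>v\<close>; convexity of the r-th power then applies pointwise.\<close>

lemma Minkowski_power:
  fixes u v :: "'a \<Rightarrow> real"
  assumes u: "\<And>i. i \<in> I \<Longrightarrow> u i \<ge> 0" and v: "\<And>i. i \<in> I \<Longrightarrow> v i \<ge> 0"
    and "U \<ge> 0" "V \<ge> 0" "finite I" "r \<ge> (1::nat)"
    and U: "(\<Sum>i\<in>I. u i ^ r) \<le> C * U ^ r" and V: "(\<Sum>i\<in>I. v i ^ r) \<le> C * V ^ r"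
  shows "(\<Sum>i\<in>I. (u i + v i) ^ r) \<le> C * (U + V) ^ r"
proof -
  \<comment> \<open>Rescaling would divide by zero when \<open>U\<close> or \<open>V\<close>
    vanishes; the bound then forces the corresponding function to be zero.\<close>
  have zero: "w i = 0" if "(\<Sum>i\<in>I. w i ^ r) \<le> C * 0 ^ r" "\<And>i. i \<in> I \<Longrightarrow> w i \<ge> 0" "i \<in> I"
    for w :: "'a \<Rightarrow> real" and i
  proof -
    have "(\<Sum>i\<in>I. w i ^ r) = 0"
      using that assms(6) by (intro antisym sum_nonneg) (auto simp: power_0_left)
    then show ?thesis using that assms(5,6) by (subst (asm) sum_nonneg_eq_0_iff) auto
  qed
  consider "U = 0" | "V = 0" | "U > 0" "V > 0" using assms(3,4) by linarith
  then show ?thesis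
  proof cases
    case 1
    then have "\<And>i. i \<in> I \<Longrightarrow> u i = 0" using zero[of u] U u by auto
    then show ?thesis using V 1 by simp
  next
    case 2
    then have "\<And>i. i \<in> I \<Longrightarrow> v i = 0" using zero[of v] V v by auto
    then show ?thesis using U 2 by simp
  next
    case 3
    define W where "W = U + V"
    have W: "W > 0" using 3 by (simp add: W_def)
    have cv: "convex_on {0..} (\<lambda>x::real. x ^ r)"
      by (cases "even r") (auto intro: convex_power_odd convex_on_subset[OF convex_power_even])
    have pt: "(u i + v i) ^ r \<le> U / W * ((W / U) ^ r * u i ^ r) + V / W * ((W / V) ^ r * v i ^ r)"
      if i: "i \<in> I" for i
    proof -
      have "1 - V / W = U / W" using W by (simp add: W_def field_simps)
      then have "u i + v i = (1 - V / W) *\<^sub>R (W / U * u i) + (V / W) *\<^sub>R (W / V * v i)"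
        using 3 W by simp
      also have "\<dots> ^ r \<le> (1 - V / W) * (W / U * u i) ^ r + (V / W) * (W / V * v i) ^ r"
        by (rule convex_onD[OF cv]) (use 3 W u[OF i] v[OF i] in \<open>auto simp: W_def\<close>)
      also have "1 - V / W = U / W" using W by (simp add: W_def field_simps)
      finally show ?thesis by (simp only: power_mult_distrib)
    qed
    have "(\<Sum>i\<in>I. (u i + v i) ^ r)
      \<le> U / W * ((W / U) ^ r * (\<Sum>i\<in>I. u i ^ r)) + V / W * ((W / V) ^ r * (\<Sum>i\<in>I. v i ^ r))"
      using sum_mono[OF pt] by (simp add: sum.distrib sum_distrib_left)
    also have "\<dots> \<le> U / W * ((W / U) ^ r * (C * U ^ r)) + V / W * ((W / V) ^ r * (C * V ^ r))"
      using 3 W U V by (intro add_mono mult_left_mono) auto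
    also have "\<dots> = U / W * (C * W ^ r) + V / W * (C * W ^ r)"
    proof -
      have "(W / X) ^ r * (C * X ^ r) = C * W ^ r" if "X > 0" for X
        using that by (simp add: power_divide)
      from this[OF 3(1)] this[OF 3(2)] show ?thesis by (simp only:)
    qed
    also have "\<dots> = C * W ^ r * ((U + V) / W)" by (simp add: field_simps add_divide_distrib)
    finally show ?thesis using W by (simp add: W_def)
  qed
qed

lemma sum_Pow_insert:
  assumes "finite S" "x \<notin> S"
  shows "(\<Sum>A\<in>Pow (insert x S). h A) = (\<Sum>A\<in>Pow S. h A + h (insert x A))"
proof -
  have "inj_on (insert x) (Pow S)" using assms by (auto simp: inj_on_def)
  moreover have "Pow S \<inter> insert x ` Pow S = {}" using assms by auto
  ultimately show ?thesis
    using assms by (simp add: Pow_insert sum.union_disjoint sum.reindex sum.distrib)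
qed

text \<open>Multiplicativity of the operator norm under tensor powers, by adding one element
  \<open>x\<close> at a time. Splitting the sets \<open>A\<close> by whether they contain
  \<open>x\<close> gives two transforms on \<open>S\<close>; the sets \<open>B\<close> and
  \<open>insert x B\<close> see them combined with coefficient 1 and \<open>\<omega>\<close>
  respectively. The two-point inequality costs one factor \<open>K\<close>, and Minkowski
  reassembles the two halves.\<close>

lemma intersection_char_bound:
  fixes \<omega> :: complex and K :: real and f :: "'a set \<Rightarrow> complex"
  assumes r: "r \<ge> (1::nat)" and "K \<ge> 0" and "finite S"
    and two: "\<And>x y. norm (x + y) ^ Suc r + norm (x + \<omega> * y) ^ Suc r
      \<le> K * (norm x powr (1 + 1/r) + norm y powr (1 + 1/r)) ^ r"
  shows "(\<Sum>B\<in>Pow S. norm (\<Sum>A\<in>Pow S. f A * \<omega> ^ card (A \<inter> B)) ^ Suc r)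
    \<le> K ^ card S * (\<Sum>A\<in>Pow S. norm (f A) powr (1 + 1/r)) ^ r"
  using \<open>finite S\<close>
proof (induction S arbitrary: f rule: finite_induct)
  case empty
  show ?case using powr_conjugate_power[of "norm (f {})" r] r by simp
next
  case (insert x S)
  define p where "p = 1 + 1 / real r"
  define F where "F = (\<lambda>g B. \<Sum>A\<in>Pow S. g A * \<omega> ^ card (A \<inter> B))"
  define f1 where "f1 = (\<lambda>A. f (insert x A))"
  have fin: "finite A" if "A \<in> Pow S" for A using that insert by (auto intro: finite_subset)
  have F0: "(\<Sum>A\<in>Pow (insert x S). f A * \<omega> ^ card (A \<inter> B)) = F f B + F f1 B"
    if "B \<in> Pow S" for B
  proof -
    have "x \<notin> B" using that insert by auto
    then show ?thesis using insert by (simp add: sum_Pow_insert F_def f1_def sum.distrib)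
  qed
  have F1: "(\<Sum>A\<in>Pow (insert x S). f A * \<omega> ^ card (A \<inter> insert x B)) = F f B + \<omega> * F f1 B"
    if "B \<in> Pow S" for B
  proof -
    have *: "A \<inter> insert x B = A \<inter> B" "insert x A \<inter> insert x B = insert x (A \<inter> B)"
      "card (insert x (A \<inter> B)) = Suc (card (A \<inter> B))" if "A \<in> Pow S" for A
      using insert that \<open>B \<in> Pow S\<close> fin[OF that] by (auto simp: card_insert_if)
    show ?thesis using insert *
      by (simp add: sum_Pow_insert F_def f1_def sum.distrib sum_distrib_left mult_ac)
  qed
  have pr: "(norm z powr p) ^ r = norm z ^ Suc r" for z :: complex
    unfolding p_def by (rule powr_conjugate_power[OF norm_ge_zero r])
  have "(\<Sum>B\<in>Pow (insert x S). norm (\<Sum>A\<in>Pow (insert x S). f A * \<omega> ^ card (A \<inter> B)) ^ Suc r)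
    = (\<Sum>B\<in>Pow S. norm (F f B + F f1 B) ^ Suc r + norm (F f B + \<omega> * F f1 B) ^ Suc r)"
    unfolding sum_Pow_insert[OF insert(1,2), of "\<lambda>B. norm (_ B) ^ Suc r"]
    by (intro sum.cong refl) (simp only: F0 F1)
  also have "\<dots> \<le> (\<Sum>B\<in>Pow S. K * (norm (F f B) powr p + norm (F f1 B) powr p) ^ r)"
    unfolding p_def by (intro sum_mono two)
  also have "\<dots> = K * (\<Sum>B\<in>Pow S. (norm (F f B) powr p + norm (F f1 B) powr p) ^ r)"
    by (simp add: sum_distrib_left)
  \<comment> \<open>Minkowski with exponent \<open>r\<close> for the functions
    \<open>norm (F f B) powr p\<close> and \<open>norm (F f1 B) powr p\<close>: by \<open>pr\<close>
    their r-th powers are the summands of the two induction hypotheses.\<close>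
  also have "(\<Sum>B\<in>Pow S. (norm (F f B) powr p + norm (F f1 B) powr p) ^ r)
    \<le> K ^ card S * ((\<Sum>A\<in>Pow S. norm (f A) powr p) + (\<Sum>A\<in>Pow S. norm (f1 A) powr p)) ^ r"
    using insert.IH[of f] insert.IH[of f1] insert(1) r
    by (intro Minkowski_power) (auto simp: pr F_def p_def[symmetric] intro: sum_nonneg simp del: power_Suc)
  also have "(\<Sum>A\<in>Pow S. norm (f A) powr p) + (\<Sum>A\<in>Pow S. norm (f1 A) powr p)
    = (\<Sum>A\<in>Pow (insert x S). norm (f A) powr p)"
    using insert by (simp add: sum_Pow_insert f1_def sum.distrib)
  finally show ?case
    using insert \<open>K \<ge> 0\<close> by (simp add: p_def mult_left_mono mult.assoc)
qed

section \<open>Exponential sums over large families\<close>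

text \<open>The norm bound for the indicator of \<open>\<A>\<close> controls the sum of
  \<open>norm (F B) ^ Suc r\<close> by \<open>K ^ n * m ^ r\<close>; a truncation turns this into a
  bound on the sum of \<open>norm (F B)\<close> over \<open>\<B>\<close>.\<close>

lemma intersection_char_sum_small:
  fixes \<omega> :: complex and \<eta> \<delta> :: real
  assumes "norm \<omega> = 1" "\<omega> \<noteq> 1" "\<eta> > 0" "\<delta> > 0"
  shows "\<forall>\<^sub>F n in sequentially. \<forall>\<A> \<B> m. \<A> \<subseteq> Pow {1..n} \<longrightarrow> \<B> \<subseteq> Pow {1..n} \<longrightarrow>
    card \<A> = m \<longrightarrow> card \<B> = m \<longrightarrow> real m > 2 powr ((1/2 + \<eta>) * real n) \<longrightarrow>
    norm (\<Sum>B\<in>\<B>. \<Sum>A\<in>\<A>. \<omega> ^ card (A \<inter> B)) \<le> \<delta> * (real m)\<^sup>2"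
proof -
  \<comment> \<open>This makes \<open>K ^ n\<close> equal to
    \<open>2 powr ((1 + \<eta>) * n)\<close>, whereas \<open>m\<^sup>2\<close> exceeds
    \<open>2 powr ((1 + 2 * \<eta>) * n)\<close>. The spare factor
    \<open>2 powr (- \<eta> * n)\<close> absorbs the constant \<open>d ^ Suc r\<close>.\<close>
  define K where "K = 2 * 2 powr \<eta>"
  have K: "K > 2" using assms by (simp add: K_def)
  obtain r :: nat where r: "r \<ge> 1" and two: "\<And>x y. norm (x + y) ^ Suc r + norm (x + \<omega> * y) ^ Suc r
      \<le> K * (norm x powr (1 + 1/r) + norm y powr (1 + 1/r)) ^ r"
    using two_point[OF assms(1,2) K] by metis
  define d where "d = \<delta> / 2"
  have d: "d > 0" using assms by (simp add: d_def)
  have "((\<lambda>n::nat. 2 powr (- \<eta> * real n)) \<longlonglongrightarrow> 0)"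
    using assms(3) by real_asymp
  then have "\<forall>\<^sub>F n::nat in sequentially. 2 powr (- \<eta> * real n) < d ^ Suc r"
    using d by (intro order_tendstoD) auto
  then show ?thesis
  proof (eventually_elim, intro allI impI)
    fix n :: nat and \<A> \<B> :: "nat set set" and m :: nat
    assume n: "2 powr (- \<eta> * real n) < d ^ Suc r"
      and sub: "\<A> \<subseteq> Pow {1..n}" "\<B> \<subseteq> Pow {1..n}" and card: "card \<A> = m" "card \<B> = m"
      and m: "real m > 2 powr ((1/2 + \<eta>) * real n)"
    have m0: "real m > 0" using m by (smt (verit) powr_gt_zero)
    define F where "F = (\<lambda>B. \<Sum>A\<in>\<A>. \<omega> ^ card (A \<inter> B))"
    have F_alt: "(\<Sum>A\<in>Pow {1..n}. of_bool (A \<in> \<A>) * \<omega> ^ card (A \<inter> B)) = F B" for B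
      unfolding F_def using sub by (intro sum.mono_neutral_cong_right) auto
    have count: "(\<Sum>A\<in>Pow {1..n}. norm (of_bool (A \<in> \<A>) :: complex) powr (1 + 1/r)) = m"
    proof -
      have "(\<Sum>A\<in>Pow {1..n}. norm (of_bool (A \<in> \<A>) :: complex) powr (1 + 1/r)) = (\<Sum>A\<in>\<A>. 1)"
        using sub by (intro sum.mono_neutral_cong_right) auto
      then show ?thesis using card by simp
    qed
    have all: "(\<Sum>B\<in>Pow {1..n}. norm (F B) ^ Suc r) \<le> K ^ n * m ^ r"
      using intersection_char_bound[OF r _ _ two, of "{1..n}" "\<lambda>A. of_bool (A \<in> \<A>)"] K
      unfolding F_alt count by simp
    have "(\<Sum>B\<in>\<B>. norm (F B) ^ Suc r) \<le> (\<Sum>B\<in>Pow {1..n}. norm (F B) ^ Suc r)"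
      using sub by (intro sum_mono2) auto
    with all have B: "(\<Sum>B\<in>\<B>. norm (F B) ^ Suc r) \<le> K ^ n * m ^ r" by linarith
    \<comment> \<open>Truncation at \<open>d * m\<close>: a value below the threshold is covered by
      the first term, a larger one by the second. After summation each term contributes at most
      \<open>d * m\<^sup>2\<close>, whence \<open>d\<close> is half of
      \<open>\<delta>\<close>.\<close>
    have pt: "x \<le> d * m + x ^ Suc r / (d * m) ^ r" if "x \<ge> 0" for x :: real
    proof (cases "x \<le> d * m")
      case True
      then show ?thesis using that d m0 by (smt (verit) divide_nonneg_nonneg zero_le_power mult_nonneg_nonneg)
    next
      case False
      have "x * (d * m) ^ r \<le> x * x ^ r"
        using False that d m0 by (intro mult_left_mono power_mono) auto
      then have "x \<le> x ^ Suc r / (d * m) ^ r" using d m0 by (simp add: field_simps)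
      then show ?thesis using d m0 by (smt (verit) mult_pos_pos)
    qed
    have "norm (\<Sum>B\<in>\<B>. F B) \<le> (\<Sum>B\<in>\<B>. norm (F B))" by (rule norm_sum)
    also have "\<dots> \<le> (\<Sum>B\<in>\<B>. d * m + norm (F B) ^ Suc r / (d * m) ^ r)"
      by (intro sum_mono pt) auto
    also have "\<dots> = d * m\<^sup>2 + (\<Sum>B\<in>\<B>. norm (F B) ^ Suc r) / (d * m) ^ r"
      by (simp only: sum.distrib sum_divide_distrib) (simp add: card power2_eq_square)
    also have "\<dots> \<le> d * m\<^sup>2 + K ^ n * m ^ r / (d * m) ^ r"
      using B d m0 by (intro add_left_mono divide_right_mono) auto
    also have "K ^ n * m ^ r / (d * m) ^ r = K ^ n / d ^ r"
      using m0 by (simp add: power_mult_distrib)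
    also have "K ^ n / d ^ r \<le> d * m\<^sup>2"
    proof -
      have "K = 2 powr (1 + \<eta>)" by (simp add: K_def powr_add)
      then have "K ^ n = 2 powr ((1 + \<eta>) * n)" by (simp add: powr_realpow[symmetric] powr_powr)
      also have "\<dots> = 2 powr (- \<eta> * n) * (2 powr ((1/2 + \<eta>) * n))\<^sup>2"
        by (simp add: power2_eq_square powr_add[symmetric] algebra_simps)
      also have "\<dots> \<le> d ^ Suc r * (real m)\<^sup>2"
        using n m d by (intro mult_mono power_mono) auto
      finally show ?thesis using d by (simp add: field_simps)
    qed
    finally show "norm (\<Sum>B\<in>\<B>. \<Sum>A\<in>\<A>. \<omega> ^ card (A \<inter> B)) \<le> \<delta> * (real m)\<^sup>2"
      by (simp add: F_def d_def)
  qed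
qed

section \<open>Detecting the intersection size by roots of unity\<close>

lemma cis_root_power_neq_1:
  assumes "0 < s" "s < N"
  shows "cis (2 * pi / real N) ^ s \<noteq> 1"
proof
  assume "cis (2 * pi / real N) ^ s = 1"
  then have "cis (2 * pi * s / N) = 1" by (simp add: Complex.DeMoivre mult_ac)
  then have "cos (2 * pi * s / N) = 1" by (simp add: complex_eq_iff)
  then obtain k :: int where "2 * pi * s / N = k * (2 * pi)"
    by (auto simp: cos_one_2pi_int)
  then have "real s = k * real N" using assms by (simp add: field_simps)
  then have "int s = k * int N" by (metis of_int_eq_iff of_int_mult of_int_of_nat_eq)
  then have "int N dvd int s" by simp
  then have "N dvd s" by simp
  then show False using assms by (simp add: nat_dvd_not_less)
qed

text \<open>The sum is \<open>N\<close> at 1 and 0 at every other N-th root of unity. Its sign is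
  what allows a sum over the good pairs to be enlarged to all pairs.\<close>

lemma root_unity_power_sum_nonneg:
  fixes z :: complex
  assumes "z ^ N = 1"
  shows "Re (\<Sum>s<N. z ^ s) \<ge> 0"
proof (cases "z = 1")
  case False
  then have "(\<Sum>s<N. z ^ s) = 0" using assms by (simp add: geometric_sum)
  then show ?thesis by simp
qed simp

theorem theorem1p5:
  fixes c :: real
  assumes "c > 0"
  shows "\<forall>\<eta>::real. \<eta> > 0 \<longrightarrow>
    (\<exists>n0::nat. \<forall>n\<ge>n0. \<forall>l::nat. 1 \<le> l \<and> l \<le> n \<longrightarrow>
      (\<forall>(\<A> :: nat set set) (\<B> :: nat set set) (m::nat).
        \<A> \<subseteq> Pow {1..n} \<and> \<B> \<subseteq> Pow {1..n} \<and> card \<A> = m \<and> card \<B> = m \<and>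
        real (card {(A, B). A \<in> \<A> \<and> B \<in> \<B> \<and> card (A \<inter> B) = l}) \<ge> c * (real m)^2
        \<longrightarrow> real m \<le> 2 powr ((1/2 + \<eta>) * real n)))"
proof (intro allI impI)
  fix \<eta> :: real assume \<eta>: "\<eta> > 0"
  \<comment> \<open>The trivial character contributes density \<open>1 / N\<close> and the others at
    most \<open>c / 2\<close> on average, so \<open>1 / N < c / 2\<close> gives the
    contradiction.\<close>
  obtain N :: nat where N: "real N > 2 / c" using reals_Archimedean2 by blast
  then have N0: "N > 0" using assms by (smt (verit) divide_pos_pos of_nat_0 gr0I)
  have cN: "c * N > 2" using N assms by (simp add: field_simps)
  define w where "w = cis (2 * pi / real N)"
  have w: "norm w = 1" "w ^ N = 1" using N0 by (simp_all add: w_def Complex.DeMoivre)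
  \<comment> \<open>Only finitely many frequencies occur, so one threshold serves them all. It is
    uniform in \<open>l\<close>, which will enter only through factors of modulus 1.\<close>
  have "\<forall>\<^sub>F n in sequentially. \<forall>s\<in>{1..<N}. \<forall>\<A> \<B> m. \<A> \<subseteq> Pow {1..n} \<longrightarrow> \<B> \<subseteq> Pow {1..n} \<longrightarrow>
    card \<A> = m \<longrightarrow> card \<B> = m \<longrightarrow> real m > 2 powr ((1/2 + \<eta>) * real n) \<longrightarrow>
    norm (\<Sum>B\<in>\<B>. \<Sum>A\<in>\<A>. (w ^ s) ^ card (A \<inter> B)) \<le> (c / 2) * (real m)\<^sup>2"
    using assms \<eta> w cis_root_power_neq_1[of _ N]
    by (intro eventually_ball_finite ballI intersection_char_sum_small)
      (auto simp: norm_power w_def[symmetric])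
  then obtain n0 where n0: "\<And>n s \<A> \<B> m. n \<ge> n0 \<Longrightarrow> s \<in> {1..<N} \<Longrightarrow> \<A> \<subseteq> Pow {1..n} \<Longrightarrow>
    \<B> \<subseteq> Pow {1..n} \<Longrightarrow> card \<A> = m \<Longrightarrow> card \<B> = m \<Longrightarrow>
    real m > 2 powr ((1/2 + \<eta>) * real n) \<Longrightarrow>
    norm (\<Sum>B\<in>\<B>. \<Sum>A\<in>\<A>. (w ^ s) ^ card (A \<inter> B)) \<le> (c / 2) * (real m)\<^sup>2"
    unfolding eventually_sequentially by meson
  show "\<exists>n0::nat. \<forall>n\<ge>n0. \<forall>l::nat. 1 \<le> l \<and> l \<le> n \<longrightarrow>
      (\<forall>(\<A> :: nat set set) (\<B> :: nat set set) (m::nat).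
        \<A> \<subseteq> Pow {1..n} \<and> \<B> \<subseteq> Pow {1..n} \<and> card \<A> = m \<and> card \<B> = m \<and>
        real (card {(A, B). A \<in> \<A> \<and> B \<in> \<B> \<and> card (A \<inter> B) = l}) \<ge> c * (real m)^2
        \<longrightarrow> real m \<le> 2 powr ((1/2 + \<eta>) * real n))"
  proof (intro exI[of _ n0] allI impI, elim conjE)
    fix n l m :: nat and \<A> \<B> :: "nat set set"
    assume n: "n \<ge> n0" and sub: "\<A> \<subseteq> Pow {1..n}" "\<B> \<subseteq> Pow {1..n}"
      and card: "card \<A> = m" "card \<B> = m"
      and many: "real (card {(A, B). A \<in> \<A> \<and> B \<in> \<B> \<and> card (A \<inter> B) = l}) \<ge> c * (real m)^2"
    show "real m \<le> 2 powr ((1/2 + \<eta>) * real n)"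
    proof (rule ccontr)
      assume "\<not> ?thesis"
      then have m: "real m > 2 powr ((1/2 + \<eta>) * real n)" by simp
      then have m0: "real m > 0" by (smt (verit) powr_gt_zero)
      have fin: "finite \<A>" "finite \<B>" using sub by (auto intro: finite_subset)
      \<comment> \<open>\<open>T k\<close> tests whether \<open>k\<close> is congruent to
        \<open>l\<close> modulo \<open>N\<close>. Sizes congruent to but different from
        \<open>l\<close> are harmless, since an upper bound for the number of good pairs
        suffices.\<close>
      define T where "T = (\<lambda>k. \<Sum>s<N. (w ^ k * cnj w ^ l) ^ s)"
      have ww: "w * cnj w = 1" using w by (simp add: complex_norm_square[symmetric])
      have T0: "Re (T k) \<ge> 0" for k
        unfolding T_def
      proof (rule root_unity_power_sum_nonneg)
        have "(w ^ k * cnj w ^ l) ^ N = (w ^ N) ^ k * cnj (w ^ N) ^ l"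
          by (simp add: power_mult_distrib power_mult[symmetric] mult.commute)
        then show "(w ^ k * cnj w ^ l) ^ N = 1" using w by simp
      qed
      have T1: "T l = N"
        by (simp add: T_def power_mult_distrib[symmetric] ww)
      define P where "P = {(A, B). A \<in> \<A> \<and> B \<in> \<B> \<and> card (A \<inter> B) = l}"
      have "N * (c * (real m)\<^sup>2) \<le> N * card P"
        using many by (simp add: P_def mult_left_mono)
      also have "\<dots> = (\<Sum>(A, B)\<in>P. Re (T (card (A \<inter> B))))"
        by (simp add: P_def T1 split_def)
      also have "\<dots> \<le> (\<Sum>(A, B)\<in>\<A> \<times> \<B>. Re (T (card (A \<inter> B))))"
        using fin T0 by (intro sum_mono2) (auto simp: P_def)
      also have "\<dots> = Re (\<Sum>A\<in>\<A>. \<Sum>B\<in>\<B>. T (card (A \<inter> B)))"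
        by (simp add: sum.cartesian_product split_def)
      also have "(\<Sum>A\<in>\<A>. \<Sum>B\<in>\<B>. T (card (A \<inter> B)))
        = (\<Sum>B\<in>\<B>. \<Sum>A\<in>\<A>. \<Sum>s<N. cnj w ^ (l * s) * (w ^ s) ^ card (A \<inter> B))"
        by (subst sum.swap)
          (simp add: T_def power_mult_distrib power_mult[symmetric] mult.commute)
      also have "\<dots> = (\<Sum>s<N. cnj w ^ (l * s) * (\<Sum>B\<in>\<B>. \<Sum>A\<in>\<A>. (w ^ s) ^ card (A \<inter> B)))"
        unfolding sum_distrib_left by (simp only: sum.swap[of _ "{..<N}"])
      also have "Re \<dots> \<le> norm \<dots>" by (rule complex_Re_le_cmod)
      also have "\<dots> \<le> (\<Sum>s<N. norm (cnj w ^ (l * s) * (\<Sum>B\<in>\<B>. \<Sum>A\<in>\<A>. (w ^ s) ^ card (A \<inter> B))))"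
        by (rule norm_sum)
      also have "\<dots> = (\<Sum>s<N. norm (\<Sum>B\<in>\<B>. \<Sum>A\<in>\<A>. (w ^ s) ^ card (A \<inter> B)))"
        using w by (simp add: norm_mult norm_power)
      \<comment> \<open>The frequency 0 is split off: its sum counts all \<open>m\<^sup>2\<close>
        pairs, with no cancellation.\<close>
      also have "{..<N} = insert 0 {1..<N}" using N0 by auto
      also have "(\<Sum>s\<in>insert 0 {1..<N}. norm (\<Sum>B\<in>\<B>. \<Sum>A\<in>\<A>. (w ^ s) ^ card (A \<inter> B)))
        = (real m)\<^sup>2 + (\<Sum>s\<in>{1..<N}. norm (\<Sum>B\<in>\<B>. \<Sum>A\<in>\<A>. (w ^ s) ^ card (A \<inter> B)))"
        by (simp add: card power2_eq_square norm_mult)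
      also have "\<dots> \<le> (real m)\<^sup>2 + (\<Sum>s\<in>{1..<N}. (c / 2) * (real m)\<^sup>2)"
        using n0[OF n _ sub card m] by (intro add_left_mono sum_mono) auto
      also have "\<dots> \<le> (real m)\<^sup>2 + N * ((c / 2) * (real m)\<^sup>2)"
        using assms by (simp add: mult_right_mono)
      finally have "(c * N) * (real m)\<^sup>2 \<le> 2 * (real m)\<^sup>2" by (simp add: algebra_simps)
      then show False using cN m0 by simp
    qed
  qed
qed

end
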